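(* Let $\mathcal{H}$ be a real Hilbert space, let $L>0$, $\mu\in[0,L[$ and $\rho\ge 0$ be such that $\mu+\rho>0$. Let $f\colon\mathcal{H}\to\mathbb{R}$ be a differentiable $\mu$-strongly convex function such that $\nabla f$ is $L$-Lipschitz continuous, and let $h\colon\mathcal{H}\to\left]-\infty,+\infty\right]$ be proper, lower semicontinuous and $\rho$-strongly convex. Set $F=f+h$ and let $x^*$ be the unique minimizer of $F$ over $\mathcal{H}$. Let $x_0$ and $y_0$ be in $\mathcal{H}$, set $$\gamma=\frac{1}{L}\quad\text{and}\quad \alpha=\frac{\sqrt{L+\rho}-\sqrt{\mu+\rho}}{\sqrt{L+\rho}+\sqrt{\mu+\rho}},$$ and let $(x_k)_{k\in\mathbb{N}}$ and $(y_k)_{k\in\mathbb{N}}$ be generated by $$(\forall k\in\mathbb{N})\quad \begin{cases} x_{k+1}=\mathrm{prox}_{\gamma h}(y_k-\gamma\nabla f(y_k))\\ y_{k+1}=x_{k+1}+\alpha(x_{k+1}-x_k).\end{cases}$$ Set $z_k=x_k+\frac{\sqrt{L+\rho}+\sqrt{\mu+\rho}}{\sqrt{\mu+\rho}}(y_k-x_k)$ for every $k\in\mathbb{N}$, and $r=1-\sqrt{\frac{\mu+\rho}{L+\rho}}$. Then, for every $k\in\mathbb{N}$, $$F(x_k)-F(x^* )\le r^k\left(F(x_0)-F(x^* )+\frac{\mu+\rho}{2}\|z_0-x^*\|^2\right),$$ $$\|z_k-x^*\|\le r^{k/2}\sqrt{\frac{2(F(x_0)-F(x^* ))}{\mu+\rho}+\|z_0-x^*\|^2},$$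 and $$\|x_k-x^*\|\le r^{k/2}\sqrt{\frac{2(F(x_0)-F(x^* ))}{\mu+\rho}+\|z_0-x^*\|^2}.$$
   Context: Conventions: for $\sigma\ge 0$, a function $\varphi\colon\mathcal{H}\to\left]-\infty,+\infty\right]$ is $\sigma$-strongly convex if $\varphi-\frac{\sigma}{2}\|\cdot\|^2$ is convex (so $0$-strongly convex means convex). For a proper lower semicontinuous convex function $\varphi$, the proximity operator is $\mathrm{prox}_{\varphi}(x)=\arg\min_{y\in\mathcal{H}}\varphi(y)+\frac12\|y-x\|^2$. $\mathbb{N}$ contains $0$, and $F$ may take the value $+\infty$. *)

theory Defs
  imports "HOL-Analysis.Analysis"
begin

text \<open>
  Functions with values in \<open>]-\<infinity>,+\<infinity>]\<close> are modelled as \<open>ereal\<close>-valued functions;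
  \<open>proper\<close> includes the requirement that the value \<open>-\<infinity>\<close> is not attained.
\<close>

definition proper :: "('a \<Rightarrow> ereal) \<Rightarrow> bool" where
  "proper \<phi> \<longleftrightarrow> (\<forall>x. \<phi> x \<noteq> -\<infinity>) \<and> (\<exists>x. \<phi> x \<noteq> \<infinity>)"

definition lower_semicontinuous :: "('a::topological_space \<Rightarrow> ereal) \<Rightarrow> bool" where
  "lower_semicontinuous \<phi> \<longleftrightarrow> (\<forall>x. \<phi> x \<le> Liminf (at x) \<phi>)"

text \<open>Meant for functions that do not attain \<open>-\<infinity>\<close>: in \<open>ereal\<close>, \<open>\<infinity> + (-\<infinity>) = \<infinity>\<close>.\<close>

definition convex_fun :: "('a::real_vector \<Rightarrow> ereal) \<Rightarrow> bool" where
  "convex_fun \<phi> \<longleftrightarrow>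
     (\<forall>x y. \<forall>t::real. 0 < t \<and> t < 1 \<longrightarrow>
        \<phi> ((1 - t) *\<^sub>R x + t *\<^sub>R y) \<le> ereal (1 - t) * \<phi> x + ereal t * \<phi> y)"

definition strongly_convex :: "real \<Rightarrow> ('a::real_inner \<Rightarrow> ereal) \<Rightarrow> bool" where
  "strongly_convex \<sigma> \<phi> \<longleftrightarrow> convex_fun (\<lambda>x. \<phi> x - ereal (\<sigma> / 2 * (norm x)\<^sup>2))"

definition grad :: "('a::real_inner \<Rightarrow> real) \<Rightarrow> 'a \<Rightarrow> 'a" where
  "grad f x = (THE D. GDERIV f x :> D)"

definition prox :: "('a::real_inner \<Rightarrow> ereal) \<Rightarrow> 'a \<Rightarrow> 'a" where
  "prox \<phi> x = arg_min (\<lambda>y. \<phi> y + ereal (1 / 2 * (norm (y - x))\<^sup>2)) (\<lambda>_. True)"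

text \<open>
  Square root on \<open>[0,+\<infinity>]\<close>, needed because the initial value of the objective may be
  \<open>+\<infinity>\<close>.  The value at \<open>-\<infinity>\<close> is a dummy.
\<close>

fun ereal_sqrt :: "ereal \<Rightarrow> ereal" where
  "ereal_sqrt (ereal a) = ereal (sqrt a)"
| "ereal_sqrt PInfty = \<infinity>"
| "ereal_sqrt MInfty = -\<infinity>"

end

theory Submission
  imports Defs
begin

text \<open>
  Write \<open>m = \<mu> + \<rho>\<close>, \<open>M = L + \<rho>\<close> and \<open>\<theta> = \<surd>(m / M)\<close>, so that \<open>r = 1 - \<theta>\<close>.  The proof shows that
  the Lyapunov function
  \<open>E\<^sub>k = F x\<^sub>k - F x\<^sup>* + m/2 \<parallel>z\<^sub>k - x\<^sup>*\<parallel>\<^sup>2\<close>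
  shrinks at least by the factor \<open>r\<close> at every iteration.  The first two bounds are the two summands of
  \<open>E\<^sub>k \<le> r\<^sup>k E\<^sub>0\<close>; the third follows because the \<open>m\<close>-strongly convex function \<open>F\<close> grows
  quadratically around its minimizer: \<open>m/2 \<parallel>x\<^sub>k - x\<^sup>*\<parallel>\<^sup>2 \<le> F x\<^sub>k - F x\<^sup>* \<le> E\<^sub>k\<close>.

  The decrease combines two facts.  The point \<open>x\<^sub>k\<^sub>+\<^sub>1\<close> minimizes the model of \<open>F\<close> in which \<open>f\<close>
  is replaced by its quadratic upper bound at \<open>y\<^sub>k\<close>.  That model is \<open>M\<close>-strongly convex,
  lies above \<open>F\<close>, and exceeds \<open>F\<close> at \<open>u\<close> by at most \<open>(L - \<mu>)/2 \<parallel>u - y\<^sub>k\<parallel>\<^sup>2\<close>.  Hence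
  \<open>F x\<^sub>k\<^sub>+\<^sub>1 + M/2 \<parallel>u - x\<^sub>k\<^sub>+\<^sub>1\<parallel>\<^sup>2 \<le> F u + (M - m)/2 \<parallel>u - y\<^sub>k\<parallel>\<^sup>2\<close> for every \<open>u\<close>
  (\<open>prox_gradient_step\<close>).  Taking \<open>u = (1 - \<theta>) x\<^sub>k + \<theta> x\<^sup>*\<close> makes \<open>u - x\<^sub>k\<^sub>+\<^sub>1\<close> equal to
  \<open>\<theta> (x\<^sup>* - z\<^sub>k\<^sub>+\<^sub>1)\<close>, and strong convexity of \<open>F\<close> on the segment from \<open>x\<^sub>k\<close> to \<open>x\<^sup>*\<close> bounds the
  right-hand side by \<open>F x\<^sup>* + r E\<^sub>k\<close> (\<open>lyapunov_decrease\<close>).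

  One existence result, \<open>strongly_convex_minimizer_exists\<close>, serves three purposes: it gives the
  minimizer of \<open>F\<close>, it makes the proximity operator well defined, and, applied to
  \<open>\<parallel>u\<parallel>\<^sup>2/2 - l u\<close>, it represents a bounded functional \<open>l\<close> by a vector, so that a
  differentiable function on a Hilbert space has a gradient.

  If \<open>F x\<^sub>0 = \<infinity>\<close>, all the right-hand sides are infinite; the finiteness of \<open>F\<close> at later iterates is
  part of \<open>prox_gradient_step\<close>.
\<close>

section \<open>Lower semicontinuous functions\<close>

lemma lower_semicontinuous_iff_eventually:
  "lower_semicontinuous \<phi> \<longleftrightarrow> (\<forall>x c. c < \<phi> x \<longrightarrow> (\<forall>\<^sub>F y in nhds x. c < \<phi> y))"
  unfolding lower_semicontinuous_def le_Liminf_iff eventually_nhds_conv_at by blast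

lemma lower_semicontinuous_continuous:
  assumes "continuous_on UNIV g"
  shows "lower_semicontinuous (\<lambda>u. ereal (g u))"
  unfolding lower_semicontinuous_iff_eventually
proof (intro allI impI)
  fix x c assume c: "c < ereal (g x)"
  have "(g \<longlongrightarrow> g x) (nhds x)"
    using assms by (simp add: continuous_on_def tendsto_nhds_iff)
  then have "((\<lambda>u. ereal (g u)) \<longlongrightarrow> ereal (g x)) (nhds x)"
    by simp
  then show "\<forall>\<^sub>F y in nhds x. c < ereal (g y)"
    using c by (rule order_tendstoD)
qed

text \<open>
  If \<open>\<phi> x + \<psi> x > d\<close> for a real \<open>d\<close>, then \<open>d\<close> splits as a sum of reals below \<open>\<phi> x\<close> and \<open>\<psi> x\<close>, also
  when one of these values is infinite.
\<close>

lemma lower_semicontinuous_add: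
  assumes \<phi>: "lower_semicontinuous \<phi>" and \<psi>: "lower_semicontinuous \<psi>"
    and \<phi>f: "\<And>u. \<phi> u \<noteq> -\<infinity>" and \<psi>f: "\<And>u. \<psi> u \<noteq> -\<infinity>"
  shows "lower_semicontinuous (\<lambda>u. \<phi> u + \<psi> u)"
  unfolding lower_semicontinuous_iff_eventually
proof (intro allI impI)
  fix x c assume c: "c < \<phi> x + \<psi> x"
  obtain d where d: "c < ereal d" "ereal d < \<phi> x + \<psi> x"
    using ereal_dense2[OF c] by blast
  have "\<exists>a b. ereal a < \<phi> x \<and> ereal b < \<psi> x \<and> d \<le> a + b"
  proof (cases "\<phi> x"; cases "\<psi> x")
    fix s t assume *: "\<phi> x = ereal s" "\<psi> x = ereal t"
    then have "d < s + t" using d by simp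
    then show ?thesis
      by (intro exI[of _ "s - (s + t - d)/2"] exI[of _ "t - (s + t - d)/2"])
        (simp add: * field_simps)
  next
    fix s assume *: "\<phi> x = ereal s" "\<psi> x = \<infinity>"
    then show ?thesis
      by (intro exI[of _ "s - 1"] exI[of _ "d - s + 1"]) simp
  next
    fix s assume *: "\<phi> x = \<infinity>" "\<psi> x = ereal s"
    then show ?thesis
      by (intro exI[of _ "d - s + 1"] exI[of _ "s - 1"]) simp
  next
    assume *: "\<phi> x = \<infinity>" "\<psi> x = \<infinity>"
    then show ?thesis
      by (intro exI[of _ "d"] exI[of _ 0]) simp
  qed (use \<phi>f[of x] \<psi>f[of x] in auto)
  then obtain a b where ab: "ereal a < \<phi> x" "ereal b < \<psi> x" "d \<le> a + b" by blast
  have "\<forall>\<^sub>F y in nhds x. ereal a < \<phi> y" "\<forall>\<^sub>F y in nhds x. ereal b < \<psi> y"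
    using \<phi> \<psi> ab unfolding lower_semicontinuous_iff_eventually by blast+
  then show "\<forall>\<^sub>F y in nhds x. c < \<phi> y + \<psi> y"
  proof eventually_elim
    case (elim y)
    have "ereal d \<le> ereal a + ereal b" using ab by simp
    also have "\<dots> \<le> \<phi> y + \<psi> y" using elim by (intro add_mono) auto
    finally show ?case using d(1) by simp
  qed
qed

lemma lower_semicontinuous_scale:
  fixes c :: real
  assumes \<phi>: "lower_semicontinuous \<phi>" and c: "c > 0"
  shows "lower_semicontinuous (\<lambda>u. ereal c * \<phi> u)"
  unfolding lower_semicontinuous_iff_eventually
proof (intro allI impI)
  fix x a assume "a < ereal c * \<phi> x"
  then obtain d where d: "a < ereal d" "ereal d < ereal c * \<phi> x"
    using ereal_dense2 by blast
  have iff: "ereal d < ereal c * \<phi> y \<longleftrightarrow> ereal (d / c) < \<phi> y" for y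
    using c by (cases "\<phi> y") (auto simp: field_simps)
  have "\<forall>\<^sub>F y in nhds x. ereal (d / c) < \<phi> y"
    using \<phi> d(2) unfolding lower_semicontinuous_iff_eventually iff by blast
  then show "\<forall>\<^sub>F y in nhds x. a < ereal c * \<phi> y"
  proof eventually_elim
    case (elim y)
    then show ?case using d(1) unfolding iff[symmetric] by (rule less_trans[rotated])
  qed
qed

section \<open>Strongly convex functions\<close>

lemma norm_convex_combination:
  fixes x y :: "'a::real_inner"
  shows "(norm ((1 - t) *\<^sub>R x + t *\<^sub>R y))\<^sup>2
    = (1 - t) * (norm x)\<^sup>2 + t * (norm y)\<^sup>2 - t * (1 - t) * (norm (x - y))\<^sup>2"
  unfolding power2_norm_eq_inner
  by (simp add: inner_simps inner_commute algebra_simps)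

text \<open>
  In this form strong convexity needs no subtraction of extended reals: where an end point has value
  \<open>\<infinity>\<close> the defining inequality is vacuous, and otherwise the squared norms combine by
  \<open>norm_convex_combination\<close>.
\<close>

lemma strongly_convex_iff:
  fixes \<phi> :: "'a::real_inner \<Rightarrow> ereal"
  assumes ninf: "\<And>u. \<phi> u \<noteq> -\<infinity>"
  shows "strongly_convex \<sigma> \<phi> \<longleftrightarrow>
    (\<forall>x y a b t. \<phi> x = ereal a \<longrightarrow> \<phi> y = ereal b \<longrightarrow> 0 < t \<longrightarrow> t < 1 \<longrightarrow>
      \<phi> ((1 - t) *\<^sub>R x + t *\<^sub>R y)
        \<le> ereal ((1 - t) * a + t * b - \<sigma> / 2 * t * (1 - t) * (norm (x - y))\<^sup>2))"
    (is "_ \<longleftrightarrow> ?R")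
proof -
  let ?q = "\<lambda>u. \<sigma> / 2 * (norm u)\<^sup>2"
  have fin: "\<phi> w - ereal (?q w) \<le> ereal (1 - t) * (\<phi> x - ereal (?q x)) + ereal t * (\<phi> y - ereal (?q y))
    \<longleftrightarrow> \<phi> w \<le> ereal ((1 - t) * a + t * b - \<sigma> / 2 * t * (1 - t) * (norm (x - y))\<^sup>2)"
    if "\<phi> x = ereal a" "\<phi> y = ereal b" "w = (1 - t) *\<^sub>R x + t *\<^sub>R y" for x y a b t w
  proof -
    have "\<sigma> / 2 * (norm w)\<^sup>2 = (1 - t) * (\<sigma> / 2 * (norm x)\<^sup>2) + t * (\<sigma> / 2 * (norm y)\<^sup>2)
        - \<sigma> / 2 * t * (1 - t) * (norm (x - y))\<^sup>2"
      unfolding that(3) norm_convex_combination by (simp add: field_simps)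
    moreover have "(1 - t) * (a - \<sigma> / 2 * (norm x)\<^sup>2) + t * (b - \<sigma> / 2 * (norm y)\<^sup>2)
        = (1 - t) * a + t * b - ((1 - t) * (\<sigma> / 2 * (norm x)\<^sup>2) + t * (\<sigma> / 2 * (norm y)\<^sup>2))"
      by (simp add: algebra_simps)
    ultimately have "r - \<sigma> / 2 * (norm w)\<^sup>2
        \<le> (1 - t) * (a - \<sigma> / 2 * (norm x)\<^sup>2) + t * (b - \<sigma> / 2 * (norm y)\<^sup>2)
      \<longleftrightarrow> r \<le> (1 - t) * a + t * b - \<sigma> / 2 * t * (1 - t) * (norm (x - y))\<^sup>2" for r
      by linarith
    then show ?thesis
      unfolding that(1,2) by (cases "\<phi> w") simp_all
  qed
  have infin: "ereal (1 - t) * (\<phi> x - ereal (?q x)) + ereal t * (\<phi> y - ereal (?q y)) = \<infinity>"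
    if "\<phi> x = \<infinity> \<or> \<phi> y = \<infinity>" "0 < t" "t < 1" for x y t
    using that ninf[of x] ninf[of y] by (cases "\<phi> x"; cases "\<phi> y") auto
  show ?thesis
  proof
    assume "strongly_convex \<sigma> \<phi>"
    then show ?R
      unfolding strongly_convex_def convex_fun_def using fin by blast
  next
    assume R: ?R
    show "strongly_convex \<sigma> \<phi>"
      unfolding strongly_convex_def convex_fun_def
    proof (intro allI impI, elim conjE)
      fix x y :: 'a and t :: real assume t: "0 < t" "t < 1"
      let ?w = "(1 - t) *\<^sub>R x + t *\<^sub>R y"
      show "\<phi> ?w - ereal (?q ?w)
        \<le> ereal (1 - t) * (\<phi> x - ereal (?q x)) + ereal t * (\<phi> y - ereal (?q y))"
      proof (cases "\<phi> x = \<infinity> \<or> \<phi> y = \<infinity>")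
        case True
        show ?thesis unfolding infin[OF True t] by simp
      next
        case False
        then obtain a b where ab: "\<phi> x = ereal a" "\<phi> y = ereal b"
          using ninf[of x] ninf[of y] by (cases "\<phi> x"; cases "\<phi> y") auto
        show ?thesis unfolding fin[OF ab refl] using R ab t by blast
      qed
    qed
  qed
qed

lemma strongly_convexD:
  fixes \<phi> :: "'a::real_inner \<Rightarrow> ereal"
  assumes "strongly_convex \<sigma> \<phi>" and "\<And>u. \<phi> u \<noteq> -\<infinity>"
    and "\<phi> x = ereal a" "\<phi> y = ereal b" "0 < t" "t < 1"
  shows "\<phi> ((1 - t) *\<^sub>R x + t *\<^sub>R y)
        \<le> ereal ((1 - t) * a + t * b - \<sigma> / 2 * t * (1 - t) * (norm (x - y))\<^sup>2)"
  using assms(1,3-) strongly_convex_iff[of \<phi> \<sigma>, OF assms(2)] by blast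

lemma strongly_convex_add:
  fixes \<phi> \<psi> :: "'a::real_inner \<Rightarrow> ereal"
  assumes \<phi>: "strongly_convex \<sigma> \<phi>" "\<And>u. \<phi> u \<noteq> -\<infinity>"
    and \<psi>: "strongly_convex \<tau> \<psi>" "\<And>u. \<psi> u \<noteq> -\<infinity>"
  shows "strongly_convex (\<sigma> + \<tau>) (\<lambda>u. \<phi> u + \<psi> u)"
proof (subst strongly_convex_iff)
  show "\<phi> u + \<psi> u \<noteq> -\<infinity>" for u using \<phi>(2) \<psi>(2) by simp
  show "\<forall>x y a b t. \<phi> x + \<psi> x = ereal a \<longrightarrow> \<phi> y + \<psi> y = ereal b \<longrightarrow> 0 < t \<longrightarrow> t < 1 \<longrightarrow>
      \<phi> ((1 - t) *\<^sub>R x + t *\<^sub>R y) + \<psi> ((1 - t) *\<^sub>R x + t *\<^sub>R y)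
        \<le> ereal ((1 - t) * a + t * b - (\<sigma> + \<tau>) / 2 * t * (1 - t) * (norm (x - y))\<^sup>2)"
  proof (intro allI impI)
    fix x y :: 'a and a b t :: real
    assume a: "\<phi> x + \<psi> x = ereal a" and b: "\<phi> y + \<psi> y = ereal b" and t: "0 < t" "t < 1"
    obtain a1 a2 where a': "\<phi> x = ereal a1" "\<psi> x = ereal a2" "a = a1 + a2"
      using a by (cases "\<phi> x"; cases "\<psi> x") auto
    obtain b1 b2 where b': "\<phi> y = ereal b1" "\<psi> y = ereal b2" "b = b1 + b2"
      using b by (cases "\<phi> y"; cases "\<psi> y") auto
    have "\<phi> ((1 - t) *\<^sub>R x + t *\<^sub>R y) + \<psi> ((1 - t) *\<^sub>R x + t *\<^sub>R y)
      \<le> ereal ((1 - t) * a1 + t * b1 - \<sigma> / 2 * t * (1 - t) * (norm (x - y))\<^sup>2)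
        + ereal ((1 - t) * a2 + t * b2 - \<tau> / 2 * t * (1 - t) * (norm (x - y))\<^sup>2)"
      using \<phi> \<psi> a' b' t by (intro add_mono strongly_convexD) auto
    also have "\<dots> = ereal ((1 - t) * a + t * b - (\<sigma> + \<tau>) / 2 * t * (1 - t) * (norm (x - y))\<^sup>2)"
      by (simp add: a' b' field_simps)
    finally show "\<phi> ((1 - t) *\<^sub>R x + t *\<^sub>R y) + \<psi> ((1 - t) *\<^sub>R x + t *\<^sub>R y)
        \<le> ereal ((1 - t) * a + t * b - (\<sigma> + \<tau>) / 2 * t * (1 - t) * (norm (x - y))\<^sup>2)" .
  qed
qed

lemma strongly_convex_scale:
  fixes \<phi> :: "'a::real_inner \<Rightarrow> ereal" and c :: real
  assumes \<phi>: "strongly_convex \<sigma> \<phi>" "\<And>u. \<phi> u \<noteq> -\<infinity>" and c: "c > 0"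
  shows "strongly_convex (c * \<sigma>) (\<lambda>u. ereal c * \<phi> u)"
proof (subst strongly_convex_iff)
  show "ereal c * \<phi> u \<noteq> -\<infinity>" for u using \<phi>(2)[of u] c by (cases "\<phi> u") auto
  show "\<forall>x y a b t. ereal c * \<phi> x = ereal a \<longrightarrow> ereal c * \<phi> y = ereal b \<longrightarrow> 0 < t \<longrightarrow> t < 1 \<longrightarrow>
      ereal c * \<phi> ((1 - t) *\<^sub>R x + t *\<^sub>R y)
        \<le> ereal ((1 - t) * a + t * b - (c * \<sigma>) / 2 * t * (1 - t) * (norm (x - y))\<^sup>2)"
  proof (intro allI impI)
    fix x y :: 'a and a b t :: real
    assume a: "ereal c * \<phi> x = ereal a" and b: "ereal c * \<phi> y = ereal b" and t: "0 < t" "t < 1"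
    obtain a' where a': "\<phi> x = ereal a'" "a = c * a'"
      using a c by (cases "\<phi> x") auto
    obtain b' where b': "\<phi> y = ereal b'" "b = c * b'"
      using b c by (cases "\<phi> y") auto
    have "ereal c * \<phi> ((1 - t) *\<^sub>R x + t *\<^sub>R y)
      \<le> ereal c * ereal ((1 - t) * a' + t * b' - \<sigma> / 2 * t * (1 - t) * (norm (x - y))\<^sup>2)"
      using \<phi> a' b' t c by (intro ereal_mult_left_mono strongly_convexD) auto
    then show "ereal c * \<phi> ((1 - t) *\<^sub>R x + t *\<^sub>R y)
        \<le> ereal ((1 - t) * a + t * b - (c * \<sigma>) / 2 * t * (1 - t) * (norm (x - y))\<^sup>2)"
      by (simp add: a' b' algebra_simps)
  qed
qed

lemma strongly_convex_half_norm_squared: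
  fixes p :: "'a::real_inner"
  shows "strongly_convex 1 (\<lambda>u. ereal (1 / 2 * (norm (u - p))\<^sup>2))"
proof -
  have "(norm ((1 - t) *\<^sub>R x + t *\<^sub>R y - p))\<^sup>2 = (1 - t) * (norm (x - p))\<^sup>2
      + t * (norm (y - p))\<^sup>2 - t * (1 - t) * (norm (x - y))\<^sup>2" for t x y
    using norm_convex_combination[of t "x - p" "y - p"] by (simp add: algebra_simps)
  then show ?thesis
    by (subst strongly_convex_iff) (auto simp: diff_divide_distrib add_divide_distrib)
qed

text \<open>
  Compare \<open>p\<close> with the point \<open>(1 - t) p + t u\<close>, divide by \<open>t\<close> and let \<open>t\<close> tend to \<open>0\<close>.
\<close>

lemma strongly_convex_growth:
  fixes \<phi> :: "'a::real_inner \<Rightarrow> ereal"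
  assumes \<phi>: "strongly_convex \<sigma> \<phi>" "\<And>u. \<phi> u \<noteq> -\<infinity>"
    and min: "is_arg_min \<phi> (\<lambda>_. True) p" and p: "\<phi> p = ereal b" and u: "\<phi> u = ereal a"
  shows "b + \<sigma> / 2 * (norm (u - p))\<^sup>2 \<le> a"
proof -
  have *: "b + \<sigma> / 2 * (1 - t) * (norm (u - p))\<^sup>2 \<le> a" if t: "0 < t" "t < 1" for t
  proof -
    have "\<phi> p \<le> \<phi> ((1 - t) *\<^sub>R p + t *\<^sub>R u)"
      using min by (auto simp: is_arg_min_def not_less)
    also have "\<dots> \<le> ereal ((1 - t) * b + t * a - \<sigma> / 2 * t * (1 - t) * (norm (p - u))\<^sup>2)"
      using \<phi> p u t by (rule strongly_convexD)
    finally have "t * (b + \<sigma> / 2 * (1 - t) * (norm (u - p))\<^sup>2) \<le> t * a"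
      by (simp add: p norm_minus_commute algebra_simps)
    then show ?thesis using t by simp
  qed
  have lim: "((\<lambda>t. b + \<sigma> / 2 * (1 - t) * (norm (u - p))\<^sup>2)
      \<longlongrightarrow> b + \<sigma> / 2 * (1 - 0) * (norm (u - p))\<^sup>2) (at_right 0)"
    by (intro tendsto_intros)
  have "\<forall>\<^sub>F t in at_right 0. b + \<sigma> / 2 * (1 - t) * (norm (u - p))\<^sup>2 \<le> a"
    using eventually_at_right_real[of 0 1] * by (auto elim!: eventually_mono)
  from tendsto_upperbound[OF lim this] show ?thesis by simp
qed

section \<open>Minimizers of strongly convex functions\<close>

text \<open>
  Lower semicontinuity gives \<open>\<phi> > a - 1\<close> on a ball of radius \<open>\<delta>\<close> around \<open>p\<close>.  From a point \<open>u\<close> at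
  distance \<open>d \<ge> \<delta>\<close>, moving towards \<open>p\<close> until distance \<open>\<delta>/2\<close> lands in that ball, and strong convexity
  on this segment yields \<open>\<phi> u \<ge> a - 2 d / \<delta> + \<sigma>/4 d\<^sup>2\<close>, which is bounded below in \<open>d\<close>.  This elementary
  argument replaces the usual affine minorant from the Hahn-Banach theorem.
\<close>

lemma strongly_convex_bounded_below:
  fixes \<phi> :: "'a::real_inner \<Rightarrow> ereal"
  assumes lsc: "lower_semicontinuous \<phi>" and \<phi>: "strongly_convex \<sigma> \<phi>" "\<And>u. \<phi> u \<noteq> -\<infinity>"
    and \<sigma>: "\<sigma> > 0" and p: "\<phi> p = ereal a"
  shows "\<exists>m. \<forall>u. ereal m \<le> \<phi> u"
proof -
  have "\<forall>\<^sub>F y in nhds p. ereal (a - 1) < \<phi> y"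
    using lsc p unfolding lower_semicontinuous_iff_eventually by simp
  then obtain \<delta> where \<delta>: "\<delta> > 0" and near: "\<And>y. dist y p < \<delta> \<Longrightarrow> ereal (a - 1) < \<phi> y"
    unfolding eventually_nhds_metric by blast
  \<comment> \<open>The minimum over \<open>d\<close> of \<open>\<sigma>/4 d\<^sup>2 - 2 d / \<delta>\<close> is \<open>- 4 / (\<sigma> \<delta>\<^sup>2)\<close>.\<close>
  define m where "m = a - 1 - 4 / (\<sigma> * \<delta>\<^sup>2)"
  have "ereal m \<le> \<phi> u" for u
  proof (cases "norm (u - p) < \<delta>")
    case True
    have "ereal m \<le> ereal (a - 1)" unfolding m_def using \<sigma> \<delta> by simp
    also have "\<dots> \<le> \<phi> u" using near[of u] True by (simp add: dist_norm)
    finally show ?thesis .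
  next
    case False
    define d where "d = norm (u - p)"
    define t where "t = \<delta> / (2 * d)"
    have d: "d \<ge> \<delta>" "d > 0" using False \<delta> by (auto simp: d_def)
    have t: "0 < t" "t \<le> 1 / 2" using \<delta> d by (auto simp: t_def field_simps)
    show ?thesis
    proof (cases "\<phi> u")
      case (real b)
      let ?w = "(1 - t) *\<^sub>R p + t *\<^sub>R u"
      have "?w - p = t *\<^sub>R (u - p)" by (simp add: algebra_simps)
      then have "dist ?w p = t * d" using t by (simp add: dist_norm d_def)
      also have "\<dots> < \<delta>" using \<delta> d by (simp add: t_def)
      finally have "ereal (a - 1) < \<phi> ?w" by (rule near)
      also have "\<phi> ?w \<le> ereal ((1 - t) * a + t * b - \<sigma> / 2 * t * (1 - t) * (norm (p - u))\<^sup>2)"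
        using \<phi> p real t by (intro strongly_convexD) auto
      finally have "a - 1 < (1 - t) * a + t * b - \<sigma> / 2 * t * (1 - t) * d\<^sup>2"
        by (simp add: norm_minus_commute d_def)
      then have "t * (a + \<sigma> / 2 * (1 - t) * d\<^sup>2) < t * b + 1"
        by (simp add: algebra_simps)
      then have "a + \<sigma> / 2 * (1 - t) * d\<^sup>2 < b + 1 / t"
        using t by (simp add: field_simps)
      moreover have "1 / t = 2 * d / \<delta>" by (simp add: t_def)
      moreover have "\<sigma> / 4 * d\<^sup>2 \<le> \<sigma> / 2 * (1 - t) * d\<^sup>2"
        using t \<sigma> by (intro mult_right_mono) (auto simp: field_simps)
      moreover have "2 * d / \<delta> \<le> \<sigma> / 4 * d\<^sup>2 + 4 / (\<sigma> * \<delta>\<^sup>2)"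
      proof -
        have "\<sigma> / 4 * d\<^sup>2 + 4 / (\<sigma> * \<delta>\<^sup>2) - 2 * d / \<delta> = (\<sigma> * \<delta> * d - 4)\<^sup>2 / (4 * \<sigma> * \<delta>\<^sup>2)"
          using \<sigma> \<delta> by (simp add: divide_simps power2_eq_square) (simp add: algebra_simps)
        also have "\<dots> \<ge> 0" using \<sigma> by simp
        finally show ?thesis by simp
      qed
      ultimately have "m \<le> b" unfolding m_def by linarith
      then show ?thesis using real by simp
    qed (use \<phi>(2)[of u] in auto)
  qed
  then show ?thesis by blast
qed

text \<open>
  A minimizing sequence is Cauchy: the value of \<open>\<phi>\<close> at the midpoint of two of its terms is at least
  the infimum, but strong convexity puts it below their average by a multiple of the squared distance.
  Lower semicontinuity then makes the limit a minimizer.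
\<close>

lemma strongly_convex_minimizer_exists:
  fixes \<phi> :: "'a::{real_inner, complete_space} \<Rightarrow> ereal"
  assumes lsc: "lower_semicontinuous \<phi>" and \<phi>: "strongly_convex \<sigma> \<phi>" and prp: "proper \<phi>"
    and \<sigma>: "\<sigma> > 0"
  shows "\<exists>p. is_arg_min \<phi> (\<lambda>_. True) p"
proof -
  have ninf: "\<phi> u \<noteq> -\<infinity>" for u using prp by (simp add: proper_def)
  obtain q where "\<phi> q \<noteq> \<infinity>" using prp by (auto simp: proper_def)
  then obtain c where q: "\<phi> q = ereal c" using ninf[of q] by (cases "\<phi> q") auto
  define A where "A = {a. \<exists>u. \<phi> u = ereal a}"
  obtain m where m: "\<And>u. ereal m \<le> \<phi> u"
    using strongly_convex_bounded_below[OF lsc \<phi> ninf \<sigma> q] by blast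
  have bdd: "bdd_below A"
  proof (rule bdd_belowI)
    fix a assume "a \<in> A"
    then obtain u where "\<phi> u = ereal a" by (auto simp: A_def)
    then show "m \<le> a" using m[of u] by simp
  qed
  have ne: "A \<noteq> {}" using q by (auto simp: A_def)
  have lower: "ereal (Inf A) \<le> \<phi> u" for u
    using cInf_lower[OF _ bdd] ninf[of u] by (cases "\<phi> u") (auto simp: A_def)
  have "\<exists>u a. \<phi> u = ereal a \<and> a < Inf A + 1 / Suc n" for n
  proof -
    have "\<exists>a\<in>A. a < Inf A + 1 / Suc n" by (intro cInf_lessD[OF ne]) simp
    then show ?thesis by (auto simp: A_def)
  qed
  then obtain X a where X: "\<And>n. \<phi> (X n) = ereal (a n)" and a: "\<And>n. a n < Inf A + 1 / Suc n"
    by metis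
  have close: "\<sigma> / 4 * (norm (X i - X j))\<^sup>2 \<le> 1 / Suc i + 1 / Suc j" for i j
  proof -
    have "ereal (Inf A) \<le> \<phi> ((1 - 1/2) *\<^sub>R X i + (1/2) *\<^sub>R X j)" by (rule lower)
    also have "\<dots> \<le> ereal ((1 - 1/2) * a i + 1/2 * a j
        - \<sigma> / 2 * (1/2) * (1 - 1/2) * (norm (X i - X j))\<^sup>2)"
      using \<phi> ninf X by (intro strongly_convexD) auto
    finally have "Inf A \<le> 1 / 2 * a i + 1 / 2 * a j - \<sigma> / 8 * (norm (X i - X j))\<^sup>2" by simp
    then show ?thesis using a[of i] a[of j] by linarith
  qed
  have "Cauchy X"
    unfolding Cauchy_def
  proof (intro allI impI)
    fix e :: real assume e: "e > 0"
    obtain N where N: "1 / Suc N < \<sigma> * e\<^sup>2 / 8"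
      using nat_approx_posE[of "\<sigma> * e\<^sup>2 / 8"] \<sigma> e by auto
    show "\<exists>M. \<forall>i\<ge>M. \<forall>j\<ge>M. dist (X i) (X j) < e"
    proof (intro exI allI impI)
      fix i j assume ij: "i \<ge> N" "j \<ge> N"
      have "1 / Suc i \<le> 1 / Suc N" "1 / Suc j \<le> 1 / Suc N"
        using ij by (simp_all add: frac_le)
      then have "\<sigma> / 4 * (norm (X i - X j))\<^sup>2 < \<sigma> / 4 * e\<^sup>2"
        using close[of i j] N by linarith
      then have "(norm (X i - X j))\<^sup>2 < e\<^sup>2" using \<sigma> by simp
      then show "dist (X i) (X j) < e"
        using e by (simp add: dist_norm power2_less_imp_less)
    qed
  qed
  then obtain p where p: "X \<longlonglongrightarrow> p" using Cauchy_convergent convergent_def by blast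
  have lim: "(\<lambda>n. Inf A + 1 / Suc n) \<longlonglongrightarrow> Inf A"
    using LIMSEQ_inverse_real_of_nat_add[of "Inf A"] by (simp add: inverse_eq_divide)
  have "\<phi> p \<le> ereal (Inf A)"
  proof (rule ccontr)
    assume "\<not> \<phi> p \<le> ereal (Inf A)"
    then have "ereal (Inf A) < \<phi> p" by simp
    then obtain d where d: "Inf A < d" "ereal d < \<phi> p"
      using ereal_dense2[of "ereal (Inf A)" "\<phi> p"] by auto
    have "\<forall>\<^sub>F n in sequentially. ereal d < \<phi> (X n)"
      using lsc d(2) p unfolding lower_semicontinuous_iff_eventually filterlim_iff by blast
    moreover have "\<forall>\<^sub>F n in sequentially. Inf A + 1 / Suc n < d"
      using lim d(1) by (rule order_tendstoD)
    ultimately have "\<forall>\<^sub>F n in sequentially. False"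
    proof eventually_elim
      case (elim n)
      then show ?case using a[of n] X[of n] by simp
    qed
    then show False by simp
  qed
  then show ?thesis
    using lower by (auto simp: is_arg_min_def not_less intro: order_trans)
qed

lemma strongly_convex_minimizer_unique:
  fixes \<phi> :: "'a::real_inner \<Rightarrow> ereal"
  assumes \<phi>: "strongly_convex \<sigma> \<phi>" and prp: "proper \<phi>" and \<sigma>: "\<sigma> > 0"
    and p: "is_arg_min \<phi> (\<lambda>_. True) p" and q: "is_arg_min \<phi> (\<lambda>_. True) q"
  shows "p = q"
proof -
  have ninf: "\<phi> u \<noteq> -\<infinity>" for u using prp by (simp add: proper_def)
  obtain w where w: "\<phi> w \<noteq> \<infinity>" using prp by (auto simp: proper_def)
  have le: "\<phi> p \<le> \<phi> u" "\<phi> q \<le> \<phi> u" for u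
    using p q by (auto simp: is_arg_min_def not_less)
  obtain b where b: "\<phi> p = ereal b"
    using le(1)[of w] w ninf[of p] by (cases "\<phi> p") auto
  have "\<phi> q = ereal b" using le(1)[of q] le(2)[of p] b by simp
  then have "b + \<sigma> / 2 * (norm (q - p))\<^sup>2 \<le> b"
    using strongly_convex_growth[OF \<phi> ninf p b] by blast
  then have "(norm (q - p))\<^sup>2 \<le> 0" using \<sigma> by (simp add: mult_le_0_iff)
  then show ?thesis by simp
qed

section \<open>Gradients of smooth strongly convex functions\<close>

text \<open>
  The representing vector is the minimizer \<open>D\<close> of \<open>\<parallel>u\<parallel>\<^sup>2/2 - l u\<close>, whose stationarity in the direction
  \<open>v\<close> reads \<open>inner v D = l v\<close>.
\<close>

lemma riesz_representation:
  fixes l :: "'a::{real_inner, complete_space} \<Rightarrow> real"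
  assumes l: "bounded_linear l"
  shows "\<exists>D. \<forall>v. l v = inner v D"
proof -
  interpret bounded_linear l by (rule l)
  let ?J = "\<lambda>u. ereal (1 / 2 * (norm (u - 0))\<^sup>2) + ereal (- l u)"
  have "strongly_convex 0 (\<lambda>u. ereal (- l u))"
    by (subst strongly_convex_iff) (auto simp: add diff scaleR algebra_simps)
  then have sc: "strongly_convex (1 + 0) ?J"
    by (intro strongly_convex_add strongly_convex_half_norm_squared) auto
  have "continuous_on UNIV l" by (intro continuous_on continuous_on_id)
  then have "lower_semicontinuous ?J"
    by (intro lower_semicontinuous_add lower_semicontinuous_continuous continuous_intros) auto
  moreover have "proper ?J" by (simp add: proper_def)
  ultimately obtain D where D: "is_arg_min ?J (\<lambda>_. True) D"
    using strongly_convex_minimizer_exists[OF _ sc] by auto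
  have "l v = inner v D" for v
  proof -
    define c N where "c = inner v D - l v" and "N = (norm v)\<^sup>2"
    \<comment> \<open>Unless \<open>c = 0\<close>, this step along \<open>v\<close> would lower the objective, by \<open>- t c - t\<^sup>2 N / 2 > 0\<close>.\<close>
    define t where "t = - c / (N + 1)"
    have N: "N \<ge> 0" by (simp add: N_def)
    have "1 / 2 * (norm D)\<^sup>2 - l D \<le> 1 / 2 * (norm (D + t *\<^sub>R v))\<^sup>2 - l (D + t *\<^sub>R v)"
      using D by (auto simp: is_arg_min_def not_less dest: spec[of _ "D + t *\<^sub>R v"])
    also have "\<dots> = 1 / 2 * (norm D)\<^sup>2 - l D + t * c + t\<^sup>2 / 2 * N"
      unfolding power2_norm_eq_inner c_def N_def
      by (simp add: add scaleR inner_simps inner_commute power2_eq_square field_simps)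
    finally have "0 \<le> t * c + t\<^sup>2 / 2 * N" by simp
    also have "\<dots> = - c\<^sup>2 * (N + 2) / (2 * (N + 1)\<^sup>2)"
      unfolding t_def using N by (simp add: divide_simps) (simp add: algebra_simps power2_eq_square)
    finally have "c\<^sup>2 * ((N + 2) / (2 * (N + 1)\<^sup>2)) \<le> 0" by simp
    moreover have "(N + 2) / (2 * (N + 1)\<^sup>2) > 0" using N by simp
    ultimately have "c\<^sup>2 \<le> 0" by (simp only: mult_le_0_iff) linarith
    then have "c = 0" by simp
    then show ?thesis by (simp add: c_def)
  qed
  then show ?thesis by blast
qed

text \<open>
  The derivative is a bounded functional, and the definite description in \<open>grad\<close> denotes the unique
  vector that represents it.
\<close>

lemma GDERIV_grad:
  fixes f :: "'a::{real_inner, complete_space} \<Rightarrow> real"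
  assumes "f differentiable (at u)"
  shows "GDERIV f u :> grad f u"
proof -
  obtain f' where f': "(f has_derivative f') (at u)"
    using assms by (auto simp: differentiable_def)
  obtain D where D: "\<And>v. f' v = inner v D"
    using riesz_representation[OF has_derivative_bounded_linear[OF f']] by blast
  then have "GDERIV f u :> D"
    using f' unfolding gderiv_def by (metis (no_types, lifting) ext)
  moreover have "E = D" if "GDERIV f u :> E" for E
  proof -
    have "f' = (\<lambda>v. inner v E)"
      using that f' unfolding gderiv_def by (metis has_derivative_unique)
    then have "inner (E - D) (E - D) = 0" using D by (metis inner_diff_right right_minus_eq)
    then show ?thesis by simp
  qed
  ultimately show ?thesis unfolding grad_def by (metis theI)
qed

lemma GDERIV_line:
  assumes "GDERIV f (p + t *\<^sub>R d) :> g"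
  shows "((\<lambda>s. f (p + s *\<^sub>R d)) has_real_derivative inner d g) (at t)"
proof -
  have "((\<lambda>s. p + s *\<^sub>R d) has_derivative (\<lambda>s. s *\<^sub>R d)) (at t)"
    by (auto intro!: derivative_eq_intros)
  from has_derivative_compose[OF this assms[unfolded gderiv_def]]
  show ?thesis
    by (simp add: has_field_derivative_def mult_commute_abs)
qed

text \<open>
  Strong convexity bounds the difference quotients of \<open>f\<close> along the segment from \<open>y\<close> to \<open>u\<close>; their limit
  at \<open>y\<close> is the directional derivative.
\<close>

lemma strongly_convex_above_tangent:
  fixes f :: "'a::real_inner \<Rightarrow> real"
  assumes f: "strongly_convex \<mu> (\<lambda>u. ereal (f u))" and g: "GDERIV f y :> g"
  shows "f y + inner (u - y) g + \<mu> / 2 * (norm (u - y))\<^sup>2 \<le> f u"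
proof -
  have "((\<lambda>s. f (y + s *\<^sub>R (u - y))) has_real_derivative inner (u - y) g) (at 0)"
    using g by (intro GDERIV_line) simp
  then have "((\<lambda>s. (f (y + s *\<^sub>R (u - y)) - f y) / s) \<longlongrightarrow> inner (u - y) g) (at_right 0)"
    unfolding has_field_derivative_iff by (simp add: filterlim_at_split)
  then have lim: "((\<lambda>s. (f (y + s *\<^sub>R (u - y)) - f y) / s + \<mu> / 2 * (1 - s) * (norm (u - y))\<^sup>2)
      \<longlongrightarrow> inner (u - y) g + \<mu> / 2 * (1 - 0) * (norm (u - y))\<^sup>2) (at_right 0)"
    by (intro tendsto_intros)
  have le: "(f (y + s *\<^sub>R (u - y)) - f y) / s + \<mu> / 2 * (1 - s) * (norm (u - y))\<^sup>2 \<le> f u - f y"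
    if s: "0 < s" "s < 1" for s
  proof -
    have eq: "(1 - s) *\<^sub>R y + s *\<^sub>R u = y + s *\<^sub>R (u - y)" by (simp add: algebra_simps)
    have "f (y + s *\<^sub>R (u - y))
        \<le> (1 - s) * f y + s * f u - \<mu> / 2 * s * (1 - s) * (norm (u - y))\<^sup>2"
      using strongly_convexD[OF f _ refl refl s, of y u]
      by (simp add: eq norm_minus_commute)
    then have "f (y + s *\<^sub>R (u - y)) - f y
        \<le> s * (f u - f y - \<mu> / 2 * (1 - s) * (norm (u - y))\<^sup>2)"
      by (simp add: algebra_simps)
    then have "(f (y + s *\<^sub>R (u - y)) - f y) / s \<le> f u - f y - \<mu> / 2 * (1 - s) * (norm (u - y))\<^sup>2"
      using s by (simp add: pos_divide_le_eq mult.commute)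
    then show ?thesis by simp
  qed
  have "\<forall>\<^sub>F s in at_right 0.
      (f (y + s *\<^sub>R (u - y)) - f y) / s + \<mu> / 2 * (1 - s) * (norm (u - y))\<^sup>2 \<le> f u - f y"
    using eventually_at_right_real[of 0 1] le by (auto elim!: eventually_mono)
  from tendsto_upperbound[OF lim this] show ?thesis by simp
qed

text \<open>
  Along the segment from \<open>y\<close> to \<open>u\<close>, the difference of \<open>f\<close> and the quadratic on the right has
  nonpositive derivative by the Cauchy-Schwarz inequality and the Lipschitz bound.
\<close>

lemma descent_lemma:
  fixes f :: "'a::{real_inner, complete_space} \<Rightarrow> real"
  assumes diff: "\<And>u. f differentiable (at u)" and lip: "L-lipschitz_on UNIV (grad f)"
  shows "f u \<le> f y + inner (u - y) (grad f y) + L / 2 * (norm (u - y))\<^sup>2"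
proof -
  define d where "d = u - y"
  define \<psi> where "\<psi> s = f (y + s *\<^sub>R d) - s * inner d (grad f y) - L / 2 * s\<^sup>2 * (norm d)\<^sup>2" for s
  have "\<psi> 1 \<le> \<psi> 0"
  proof (rule DERIV_nonpos_imp_nonincreasing[of 0 1 \<psi>])
    fix s :: real assume s: "0 \<le> s"
    have "(\<psi> has_real_derivative inner d (grad f (y + s *\<^sub>R d)) - inner d (grad f y)
        - L * s * (norm d)\<^sup>2) (at s)"
      unfolding \<psi>_def
      by (rule derivative_eq_intros GDERIV_line GDERIV_grad diff refl | simp)+
    moreover have "inner d (grad f (y + s *\<^sub>R d)) - inner d (grad f y) - L * s * (norm d)\<^sup>2 \<le> 0"
    proof -
      have "inner d (grad f (y + s *\<^sub>R d) - grad f y)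
          \<le> norm d * norm (grad f (y + s *\<^sub>R d) - grad f y)" by (rule norm_cauchy_schwarz)
      also have "norm (grad f (y + s *\<^sub>R d) - grad f y) \<le> L * (s * norm d)"
        using lipschitz_onD[OF lip, of "y + s *\<^sub>R d" y] s by (simp add: dist_norm)
      finally have "inner d (grad f (y + s *\<^sub>R d) - grad f y) \<le> norm d * (L * (s * norm d))"
        by (simp add: mult_left_mono)
      then show ?thesis
        by (simp add: inner_diff_right power2_eq_square algebra_simps)
    qed
    ultimately show "\<exists>D. (\<psi> has_real_derivative D) (at s) \<and> D \<le> 0" by blast
  qed simp
  then show ?thesis by (simp add: \<psi>_def d_def)
qed

section \<open>The proximal gradient step\<close>

lemma prox_is_arg_min:
  fixes h :: "'a::{real_inner, complete_space} \<Rightarrow> ereal"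
  assumes prp: "proper h" and lsc: "lower_semicontinuous h" and sc: "strongly_convex \<rho> h"
    and \<rho>: "\<rho> \<ge> 0"
  shows "is_arg_min (\<lambda>u. h u + ereal (1 / 2 * (norm (u - v))\<^sup>2)) (\<lambda>_. True) (prox h v)"
proof -
  let ?\<phi> = "\<lambda>u. h u + ereal (1 / 2 * (norm (u - v))\<^sup>2)"
  have ninf: "h u \<noteq> -\<infinity>" for u using prp by (simp add: proper_def)
  have "lower_semicontinuous ?\<phi>"
    using lsc ninf
    by (intro lower_semicontinuous_add lower_semicontinuous_continuous continuous_intros) auto
  moreover have "strongly_convex (\<rho> + 1) ?\<phi>"
    using sc ninf by (intro strongly_convex_add strongly_convex_half_norm_squared) auto
  moreover have "proper ?\<phi>" using prp by (auto simp: proper_def)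
  ultimately have "\<exists>p. is_arg_min ?\<phi> (\<lambda>_. True) p"
    using \<rho> by (intro strongly_convex_minimizer_exists[where \<sigma> = "\<rho> + 1"]) auto
  then show ?thesis unfolding prox_def arg_min_def by (rule someI_ex)
qed

text \<open>
  The objective that defines \<open>prox h v\<close> is \<open>(\<rho> + 1)\<close>-strongly convex, so it grows quadratically around
  \<open>prox h v\<close>; its minimum is finite because \<open>h\<close> is proper.
\<close>

lemma prox_growth:
  fixes h :: "'a::{real_inner, complete_space} \<Rightarrow> ereal"
  assumes prp: "proper h" and lsc: "lower_semicontinuous h" and sc: "strongly_convex \<rho> h"
    and \<rho>: "\<rho> \<ge> 0"
  obtains b where "h (prox h v) = ereal b"
    and "\<And>u a. h u = ereal a \<Longrightarrow> b + 1 / 2 * (norm (prox h v - v))\<^sup>2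
        + (\<rho> + 1) / 2 * (norm (u - prox h v))\<^sup>2 \<le> a + 1 / 2 * (norm (u - v))\<^sup>2"
proof -
  let ?\<phi> = "\<lambda>u. h u + ereal (1 / 2 * (norm (u - v))\<^sup>2)"
  let ?p = "prox h v"
  have ninf: "h u \<noteq> -\<infinity>" for u using prp by (simp add: proper_def)
  note min = prox_is_arg_min[OF prp lsc sc \<rho>, of v]
  obtain w where w: "h w \<noteq> \<infinity>" using prp by (auto simp: proper_def)
  have "?\<phi> ?p \<le> ?\<phi> w" using min by (auto simp: is_arg_min_def not_less)
  then obtain b where b: "h ?p = ereal b"
    using w ninf[of ?p] by (cases "h ?p"; cases "h w") auto
  have "strongly_convex (\<rho> + 1) ?\<phi>"
    using sc ninf by (intro strongly_convex_add strongly_convex_half_norm_squared) auto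
  from strongly_convex_growth[OF this _ min, of "b + 1 / 2 * (norm (?p - v))\<^sup>2"]
  show thesis using b ninf by (intro that[of b]) auto
qed

text \<open>
  Multiplied by \<open>L\<close> and up to a constant, the proximal objective is the model
  \<open>h u + inner (u - y) (grad f y) + L/2 \<parallel>u - y\<parallel>\<^sup>2\<close>, so that \<open>prox_growth\<close> compares the values of this
  model at \<open>u\<close> and at \<open>p\<close> with modulus \<open>L + \<rho>\<close>.  At \<open>p\<close> the model is bounded below by the descent lemma, at
  \<open>u\<close> it is bounded above because \<open>f\<close> lies above its tangents.
\<close>

lemma prox_gradient_step:
  fixes f :: "'a::{real_inner, complete_space} \<Rightarrow> real" and h :: "'a \<Rightarrow> ereal" and y :: 'a
  assumes L: "L > 0" and \<rho>: "\<rho> \<ge> 0"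
    and diff: "\<And>u. f differentiable (at u)" and fsc: "strongly_convex \<mu> (\<lambda>u. ereal (f u))"
    and lip: "L-lipschitz_on UNIV (grad f)"
    and prp: "proper h" and lsc: "lower_semicontinuous h" and sc: "strongly_convex \<rho> h"
    and p: "p = prox (\<lambda>u. ereal (1 / L) * h u) (y - (1 / L) *\<^sub>R grad f y)"
  obtains P where "ereal (f p) + h p = ereal P"
    and "\<And>u a. ereal (f u) + h u = ereal a \<Longrightarrow> P + (L + \<rho>) / 2 * (norm (u - p))\<^sup>2
      \<le> a + (L - \<mu>) / 2 * (norm (u - y))\<^sup>2"
proof -
  let ?h = "\<lambda>u. ereal (1 / L) * h u"
  let ?g = "grad f y"
  let ?v = "y - (1 / L) *\<^sub>R ?g"
  have ninf: "h u \<noteq> -\<infinity>" for u using prp by (simp add: proper_def)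
  have iff: "?h u = ereal c \<longleftrightarrow> h u = ereal (L * c)" for u c
    using L by (cases "h u") (auto simp: field_simps)
  have "?h u \<noteq> -\<infinity>" for u using L ninf[of u] by (cases "h u") auto
  moreover have "\<exists>u. ?h u \<noteq> \<infinity>"
    using prp L by (auto simp: proper_def)
  ultimately have prp': "proper ?h" by (simp add: proper_def)
  have lsc': "lower_semicontinuous ?h" using L by (intro lower_semicontinuous_scale lsc) auto
  have sc': "strongly_convex (1 / L * \<rho>) ?h" using L by (intro strongly_convex_scale sc ninf) auto
  obtain c where c: "?h p = ereal c"
    and growth: "\<And>u a. ?h u = ereal a \<Longrightarrow> c + 1 / 2 * (norm (p - ?v))\<^sup>2
        + (1 / L * \<rho> + 1) / 2 * (norm (u - p))\<^sup>2 \<le> a + 1 / 2 * (norm (u - ?v))\<^sup>2"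
    using prox_growth[OF prp' lsc' sc', of ?v] L \<rho> unfolding p[symmetric] by auto
  have sq: "L * (1 / 2 * (norm (w - ?v))\<^sup>2)
      = L / 2 * (norm (w - y))\<^sup>2 + inner (w - y) ?g + (norm ?g)\<^sup>2 / (2 * L)" for w
  proof -
    have "w - ?v = (w - y) + (1 / L) *\<^sub>R ?g" by simp
    then have "(norm (w - ?v))\<^sup>2
        = (norm (w - y))\<^sup>2 + 2 / L * inner (w - y) ?g + (norm ?g)\<^sup>2 / L\<^sup>2"
      using dot_norm[of "w - y" "(1 / L) *\<^sub>R ?g"] by (simp add: power_divide field_simps)
    then show ?thesis using L by (simp add: field_simps power2_eq_square)
  qed
  show thesis
  proof (rule that)
    show "ereal (f p) + h p = ereal (f p + L * c)" using c iff by simp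
    fix u a' assume "ereal (f u) + h u = ereal a'"
    then obtain a where u: "h u = ereal a" and a': "a' = f u + a" by (cases "h u") auto
    then have "?h u = ereal (a / L)" using L by simp
    from growth[OF this] have "L * (c + 1 / 2 * (norm (p - ?v))\<^sup>2 + (1 / L * \<rho> + 1) / 2 * (norm (u - p))\<^sup>2)
        \<le> L * (a / L + 1 / 2 * (norm (u - ?v))\<^sup>2)"
      using L by (intro mult_left_mono) auto
    moreover have "L * ((1 / L * \<rho> + 1) / 2 * (norm (u - p))\<^sup>2) = (L + \<rho>) / 2 * (norm (u - p))\<^sup>2"
      using L by (simp add: field_simps)
    moreover have "L * (a / L) = a" using L by simp
    ultimately have "L * c + L * (1 / 2 * (norm (p - ?v))\<^sup>2) + (L + \<rho>) / 2 * (norm (u - p))\<^sup>2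
        \<le> a + L * (1 / 2 * (norm (u - ?v))\<^sup>2)"
      unfolding distrib_left by linarith
    then have "L * c + L / 2 * (norm (p - y))\<^sup>2 + inner (p - y) ?g + (L + \<rho>) / 2 * (norm (u - p))\<^sup>2
        \<le> a + L / 2 * (norm (u - y))\<^sup>2 + inner (u - y) ?g"
      unfolding sq by linarith
    moreover have "f p \<le> f y + inner (p - y) ?g + L / 2 * (norm (p - y))\<^sup>2"
      by (rule descent_lemma[OF diff lip])
    moreover have "f y + inner (u - y) ?g + \<mu> / 2 * (norm (u - y))\<^sup>2 \<le> f u"
      by (rule strongly_convex_above_tangent[OF fsc GDERIV_grad[OF diff]])
    moreover have "(L - \<mu>) / 2 * (norm (u - y))\<^sup>2 = L / 2 * (norm (u - y))\<^sup>2 - \<mu> / 2 * (norm (u - y))\<^sup>2"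
      by (simp add: field_simps)
    ultimately show "f p + L * c + (L + \<rho>) / 2 * (norm (u - p))\<^sup>2
        \<le> a' + (L - \<mu>) / 2 * (norm (u - y))\<^sup>2" unfolding a' by linarith
  qed
qed

section \<open>Decrease of the Lyapunov function\<close>

text \<open>
  One iteration, with \<open>X\<close>, \<open>S\<close> and \<open>P\<close> the values at the current iterate \<open>x\<close>, at the reference point
  \<open>s\<close> and at the next iterate \<open>p\<close>.  The hypothesis \<open>step\<close> is used at the point \<open>u\<close> of the segment from \<open>x\<close> to
  \<open>s\<close> for which \<open>u - p = - \<theta> (z' - s)\<close>.  The extrapolation \<open>y\<close> is such that \<open>y - u\<close> is
  \<open>\<theta>\<close> times a convex combination of \<open>x - s\<close> and \<open>z - s\<close>; by convexity of the squared norm, the error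
  term splits into a multiple of \<open>\<parallel>z - s\<parallel>\<^sup>2\<close>, which the Lyapunov function absorbs, and a multiple of
  \<open>\<parallel>x - s\<parallel>\<^sup>2\<close>, which the strong convexity of \<open>\<Phi>\<close> cancels exactly.
\<close>

lemma lyapunov_decrease:
  fixes \<Phi> :: "'a::real_inner \<Rightarrow> ereal"
  assumes M: "M > 0" and \<theta>: "0 < \<theta>" "\<theta> < 1" and m: "m = \<theta>\<^sup>2 * M"
    and sc: "strongly_convex m \<Phi>" and ninf: "\<And>u. \<Phi> u \<noteq> -\<infinity>"
    and x: "\<Phi> x = ereal X" and s: "\<Phi> s = ereal S"
    and y: "y = x + (\<theta> / (1 + \<theta>)) *\<^sub>R (z - x)"
    and z': "z' = x + (1 / \<theta>) *\<^sub>R (p - x)"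
    and step: "\<And>u a. \<Phi> u = ereal a \<Longrightarrow>
      P + M / 2 * (norm (u - p))\<^sup>2 \<le> a + (M - m) / 2 * (norm (u - y))\<^sup>2"
  shows "P - S + m / 2 * (norm (z' - s))\<^sup>2 \<le> (1 - \<theta>) * (X - S + m / 2 * (norm (z - s))\<^sup>2)"
proof -
  define u where "u = (1 - \<theta>) *\<^sub>R x + \<theta> *\<^sub>R s"
  define v w where "v = x - s" and "w = z - s"
  have convex: "\<Phi> u \<le> ereal ((1 - \<theta>) * X + \<theta> * S - m / 2 * \<theta> * (1 - \<theta>) * (norm v)\<^sup>2)"
    unfolding u_def v_def by (rule strongly_convexD[OF sc ninf x s \<theta>])
  then obtain a where a: "\<Phi> u = ereal a" using ninf[of u] by (cases "\<Phi> u") auto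
  have "u - p = - \<theta> *\<^sub>R (z' - s)"
    using \<theta> by (simp add: u_def z' algebra_simps)
  then have up: "M / 2 * (norm (u - p))\<^sup>2 = m / 2 * (norm (z' - s))\<^sup>2"
    using \<theta> by (simp add: m power_mult_distrib)
  define t where "t = 1 / (1 + \<theta>)"
  have t: "t * (1 + \<theta>) = 1" "0 < t" "t < 1" using \<theta> by (auto simp: t_def field_simps)
  have "u - y = - \<theta> *\<^sub>R ((1 - t) *\<^sub>R v + t *\<^sub>R w)"
  proof -
    have "1 - t = \<theta> * t" using t(1) by (simp add: algebra_simps)
    moreover have "\<theta> / (1 + \<theta>) = \<theta> * t" by (simp add: t_def)
    ultimately show ?thesis
      unfolding u_def y v_def w_def
      using t(1) by (simp add: algebra_simps)
  qed
  then have "(norm (u - y))\<^sup>2 = \<theta>\<^sup>2 * (norm ((1 - t) *\<^sub>R v + t *\<^sub>R w))\<^sup>2"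
    using \<theta> by (simp add: power_mult_distrib)
  also have "\<dots> \<le> \<theta>\<^sup>2 * ((1 - t) * (norm v)\<^sup>2 + t * (norm w)\<^sup>2)"
    using t unfolding norm_convex_combination by (intro mult_left_mono) auto
  finally have "(M - m) / 2 * (norm (u - y))\<^sup>2
      \<le> (M - m) / 2 * (\<theta>\<^sup>2 * ((1 - t) * (norm v)\<^sup>2 + t * (norm w)\<^sup>2))"
    using M \<theta> by (intro mult_left_mono) (auto simp: m field_simps power_le_one)
  also have "\<dots> = m / 2 * (1 - \<theta>) * (\<theta> * (norm v)\<^sup>2 + (norm w)\<^sup>2)"
  proof -
    have "(M - m) * \<theta>\<^sup>2 = m * (1 - \<theta>) * (1 + \<theta>)"
      by (simp add: m algebra_simps power2_eq_square)
    moreover have "(1 + \<theta>) * (1 - t) = \<theta>" using t(1) by (simp add: algebra_simps)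
    ultimately have "(M - m) * \<theta>\<^sup>2 * (1 - t) = m * (1 - \<theta>) * \<theta>" "(M - m) * \<theta>\<^sup>2 * t = m * (1 - \<theta>)"
      using t(1) by (simp_all add: mult.assoc mult.commute[of "1 + \<theta>"])
    moreover have "(M - m) / 2 * (\<theta>\<^sup>2 * ((1 - t) * (norm v)\<^sup>2 + t * (norm w)\<^sup>2))
        = ((M - m) * \<theta>\<^sup>2 * (1 - t)) / 2 * (norm v)\<^sup>2 + ((M - m) * \<theta>\<^sup>2 * t) / 2 * (norm w)\<^sup>2"
      by (simp add: field_simps)
    ultimately show ?thesis by (simp only:) (simp add: field_simps)
  qed
  finally have "(M - m) / 2 * (norm (u - y))\<^sup>2 \<le> m / 2 * (1 - \<theta>) * (\<theta> * (norm v)\<^sup>2 + (norm w)\<^sup>2)" .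
  moreover have "a \<le> (1 - \<theta>) * X + \<theta> * S - m / 2 * \<theta> * (1 - \<theta>) * (norm v)\<^sup>2"
    using convex a by simp
  moreover have "P + m / 2 * (norm (z' - s))\<^sup>2 \<le> a + (M - m) / 2 * (norm (u - y))\<^sup>2"
    using step[OF a] up by simp
  ultimately have "P + m / 2 * (norm (z' - s))\<^sup>2
      \<le> (1 - \<theta>) * X + \<theta> * S - m / 2 * \<theta> * (1 - \<theta>) * (norm v)\<^sup>2
        + m / 2 * (1 - \<theta>) * (\<theta> * (norm v)\<^sup>2 + (norm w)\<^sup>2)" by linarith
  also have "\<dots> = S + (1 - \<theta>) * (X - S + m / 2 * (norm w)\<^sup>2)"
    by (simp add: algebra_simps)
  finally show ?thesis by (simp add: w_def)
qed

section \<open>Linear convergence\<close>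

theorem corollary3p1:
  fixes f :: "'a::{real_inner, complete_space} \<Rightarrow> real"
    and h F :: "'a \<Rightarrow> ereal"
    and L \<mu> \<rho> \<gamma> \<alpha> r :: real
    and xs :: 'a
    and x y z :: "nat \<Rightarrow> 'a"
  assumes "L > 0" and "0 \<le> \<mu>" and "\<mu> < L" and "\<rho> \<ge> 0" and "\<mu> + \<rho> > 0"
    and "\<forall>u. f differentiable (at u)"
    and "strongly_convex \<mu> (\<lambda>u. ereal (f u))"
    and "L-lipschitz_on UNIV (grad f)"
    and "proper h" and "lower_semicontinuous h" and "strongly_convex \<rho> h"
    and "F = (\<lambda>u. ereal (f u) + h u)"
    and "xs = arg_min F (\<lambda>_. True)"
    and "\<gamma> = 1 / L"
    and "\<alpha> = (sqrt (L + \<rho>) - sqrt (\<mu> + \<rho>)) / (sqrt (L + \<rho>) + sqrt (\<mu> + \<rho>))"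
    and "\<forall>k. x (Suc k) = prox (\<lambda>u. ereal \<gamma> * h u) (y k - \<gamma> *\<^sub>R grad f (y k))"
    and "\<forall>k. y (Suc k) = x (Suc k) + \<alpha> *\<^sub>R (x (Suc k) - x k)"
    and "\<forall>k. z k = x k + ((sqrt (L + \<rho>) + sqrt (\<mu> + \<rho>)) / sqrt (\<mu> + \<rho>)) *\<^sub>R (y k - x k)"
    and "r = 1 - sqrt ((\<mu> + \<rho>) / (L + \<rho>))"
  shows "(\<exists>!u. is_arg_min F (\<lambda>_. True) u) \<and>
    (\<forall>k.
      F (x k) - F xs
        \<le> ereal (r ^ k) * (F (x 0) - F xs + ereal ((\<mu> + \<rho>) / 2 * (norm (z 0 - xs))\<^sup>2)) \<and>
      ereal (norm (z k - xs))
        \<le> ereal (r powr (real k / 2)) *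
          ereal_sqrt (2 * (F (x 0) - F xs) / ereal (\<mu> + \<rho>) + ereal ((norm (z 0 - xs))\<^sup>2)) \<and>
      ereal (norm (x k - xs))
        \<le> ereal (r powr (real k / 2)) *
          ereal_sqrt (2 * (F (x 0) - F xs) / ereal (\<mu> + \<rho>) + ereal ((norm (z 0 - xs))\<^sup>2)))"
proof -
  define M m \<theta> where "M = L + \<rho>" and "m = \<mu> + \<rho>" and "\<theta> = sqrt (m / M)"
  have Mm: "0 < m" "m < M" using assms(1-5) by (auto simp: M_def m_def)
  have \<theta>: "0 < \<theta>" "\<theta> < 1" using Mm by (auto simp: \<theta>_def)
  have m: "m = \<theta>\<^sup>2 * M" using Mm by (simp add: \<theta>_def)
  have r: "r = 1 - \<theta>" "r > 0" using assms(19) \<theta> by (auto simp: \<theta>_def m_def M_def)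
  have sqrt_m: "sqrt m = \<theta> * sqrt M" using Mm by (simp add: \<theta>_def real_sqrt_divide)
  have sqrt_M: "sqrt M > 0" using Mm by simp
  have coeff: "(sqrt M + sqrt m) / sqrt m = (1 + \<theta>) / \<theta>"
  proof -
    have "sqrt M + sqrt m = sqrt M * (1 + \<theta>)" "sqrt m = sqrt M * \<theta>"
      by (simp_all add: sqrt_m algebra_simps)
    then show ?thesis using sqrt_M by simp
  qed
  have \<alpha>: "\<alpha> = (1 - \<theta>) / (1 + \<theta>)"
  proof -
    have "sqrt M - sqrt m = sqrt M * (1 - \<theta>)" "sqrt M + sqrt m = sqrt M * (1 + \<theta>)"
      by (simp_all add: sqrt_m algebra_simps)
    then show ?thesis using sqrt_M assms(15) by (simp add: m_def M_def)
  qed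
  \<comment> \<open>The recursion for \<open>y\<close> and \<open>z\<close>, in the form required by \<open>lyapunov_decrease\<close>.\<close>
  have z: "z k = x k + ((1 + \<theta>) / \<theta>) *\<^sub>R (y k - x k)" for k
    using assms(18) coeff by (simp add: m_def M_def)
  have y_conv: "y k = x k + (\<theta> / (1 + \<theta>)) *\<^sub>R (z k - x k)" for k
    using \<theta> by (simp add: z)
  have z_Suc: "z (Suc k) = x k + (1 / \<theta>) *\<^sub>R (x (Suc k) - x k)" for k
  proof -
    have "(1 + \<theta>) / \<theta> * \<alpha> = (1 - \<theta>) / \<theta>" using \<theta> by (simp add: \<alpha>)
    also have "\<dots> = 1 / \<theta> - 1" using \<theta> by (simp add: diff_divide_distrib)
    finally have coeff_\<alpha>: "(1 + \<theta>) / \<theta> * \<alpha> = 1 / \<theta> - 1" .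
    have "y (Suc k) - x (Suc k) = \<alpha> *\<^sub>R (x (Suc k) - x k)" using assms(17) by simp
    then have "z (Suc k) = x (Suc k) + (1 / \<theta> - 1) *\<^sub>R (x (Suc k) - x k)"
      unfolding z[of "Suc k"] by (simp only: scaleR_scaleR coeff_\<alpha>)
    also have "\<dots> = x k + (1 / \<theta>) *\<^sub>R (x (Suc k) - x k)"
      unfolding scaleR_diff_left by simp
    finally show ?thesis .
  qed

  have diff: "f differentiable (at u)" for u using assms(6) by blast
  have ninf_h: "h u \<noteq> -\<infinity>" for u using assms(9) by (simp add: proper_def)
  have F: "F u = ereal (f u) + h u" for u using assms(12) by simp
  have ninf: "F u \<noteq> -\<infinity>" for u using ninf_h[of u] by (simp add: F)
  have proper_F: "proper F" using assms(9) by (auto simp: proper_def F)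
  have "continuous_on UNIV f"
    using diff by (simp add: differentiable_imp_continuous_within continuous_at_imp_continuous_on)
  then have lsc_F: "lower_semicontinuous F"
    unfolding assms(12) using assms(10) ninf_h
    by (intro lower_semicontinuous_add lower_semicontinuous_continuous) auto
  have sc_F: "strongly_convex m F"
    unfolding assms(12) m_def using assms(7,11) ninf_h
    by (intro strongly_convex_add) auto
  obtain p where p: "is_arg_min F (\<lambda>_. True) p"
    using strongly_convex_minimizer_exists[OF lsc_F sc_F proper_F Mm(1)] by blast
  have unique: "\<exists>!u. is_arg_min F (\<lambda>_. True) u"
    using p strongly_convex_minimizer_unique[OF sc_F proper_F Mm(1)] by blast
  have xs: "is_arg_min F (\<lambda>_. True) xs"
    unfolding assms(13) arg_min_def using p by (rule someI)
  obtain S where S: "F xs = ereal S"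
  proof -
    obtain w where "F w \<noteq> \<infinity>" using proper_F by (auto simp: proper_def)
    moreover have "F xs \<le> F w" using xs by (auto simp: is_arg_min_def not_less)
    ultimately show thesis using ninf[of xs] that by (cases "F xs") auto
  qed

  have step: "\<exists>P. F (x (Suc k)) = ereal P \<and> (\<forall>u a. F u = ereal a \<longrightarrow>
      P + M / 2 * (norm (u - x (Suc k)))\<^sup>2 \<le> a + (M - m) / 2 * (norm (u - y k))\<^sup>2)" for k
  proof -
    have "x (Suc k) = prox (\<lambda>u. ereal (1 / L) * h u) (y k - (1 / L) *\<^sub>R grad f (y k))"
      using assms(14,16) by simp
    from prox_gradient_step[OF assms(1,4) diff assms(7-11) this]
    obtain P where "ereal (f (x (Suc k))) + h (x (Suc k)) = ereal P"
      and "\<And>u a. ereal (f u) + h u = ereal a \<Longrightarrow> P + (L + \<rho>) / 2 * (norm (u - x (Suc k)))\<^sup>2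
        \<le> a + (L - \<mu>) / 2 * (norm (u - y k))\<^sup>2" by blast
    then show ?thesis by (auto simp: F M_def m_def)
  qed

  show ?thesis
  proof (intro conjI allI unique)
    fix k
    let ?Q = "2 * (F (x 0) - F xs) / ereal (\<mu> + \<rho>) + ereal ((norm (z 0 - xs))\<^sup>2)"
    have "F (x k) - F xs
        \<le> ereal (r ^ k) * (F (x 0) - F xs + ereal ((\<mu> + \<rho>) / 2 * (norm (z 0 - xs))\<^sup>2)) \<and>
      ereal (norm (z k - xs)) \<le> ereal (r powr (real k / 2)) * ereal_sqrt ?Q \<and>
      ereal (norm (x k - xs)) \<le> ereal (r powr (real k / 2)) * ereal_sqrt ?Q"
    proof (cases "F (x 0)")
      case PInf
      have "?Q = \<infinity>" using PInf S Mm by (simp add: m_def)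
      moreover have "ereal_sqrt \<infinity> = \<infinity>"
        using ereal_sqrt.simps(2) unfolding infinity_ereal_def .
      ultimately have "ereal_sqrt ?Q = \<infinity>" by (simp only:)
      then show ?thesis using PInf S r by simp
    next
      case MInf
      then show ?thesis using ninf by simp
    next
      case (real X0)
      have "\<exists>X. F (x k) = ereal X" for k
        using real step by (cases k) blast+
      then obtain X where X: "\<And>k. F (x k) = ereal (X k)" by metis
      define E where "E k = X k - S + m / 2 * (norm (z k - xs))\<^sup>2" for k
      have decrease: "E (Suc k) \<le> r * E k" for k
      proof -
        have M: "M > 0" using Mm by simp
        have "X (Suc k) + M / 2 * (norm (u - x (Suc k)))\<^sup>2 \<le> a + (M - m) / 2 * (norm (u - y k))\<^sup>2"
          if "F u = ereal a" for u a
          using step[of k] that X[of "Suc k"] by fastforce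
        from lyapunov_decrease[OF M \<theta> m sc_F ninf X S y_conv z_Suc this]
        show ?thesis unfolding E_def r(1) by simp
      qed
      have E: "E k \<le> r ^ k * E 0" for k
      proof (induction k)
        case (Suc k)
        have "E (Suc k) \<le> r * E k" by (rule decrease)
        also have "\<dots> \<le> r * (r ^ k * E 0)" using Suc r by (intro mult_left_mono) auto
        finally show ?case by (simp add: mult.assoc)
      qed simp
      have growth: "S + m / 2 * (norm (x k - xs))\<^sup>2 \<le> X k"
        by (rule strongly_convex_growth[OF sc_F ninf xs S X])
      have nonneg: "m / 2 * (norm u)\<^sup>2 \<ge> 0" for u :: 'a using Mm by simp
      define Q where "Q = 2 * (X 0 - S) / m + (norm (z 0 - xs))\<^sup>2"
      have Q: "E 0 = m / 2 * Q" using Mm by (simp add: E_def Q_def field_simps)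
      have powr: "r powr (real k / 2) = sqrt (r ^ k)"
        using r by (simp add: powr_half_sqrt[symmetric] powr_powr flip: powr_realpow)
      have le: "norm u \<le> r powr (real k / 2) * sqrt Q" if "m / 2 * (norm u)\<^sup>2 \<le> E k" for u :: 'a
      proof -
        have "m / 2 * (norm u)\<^sup>2 \<le> m / 2 * (r ^ k * Q)" using that E[of k] Q by (simp add: algebra_simps)
        then have "(norm u)\<^sup>2 \<le> r ^ k * Q" using Mm by simp
        then show ?thesis unfolding powr real_sqrt_mult[symmetric] by (rule real_le_rsqrt)
      qed
      have Q': "ereal_sqrt ?Q = ereal (sqrt Q)"
        using Mm by (simp add: X S Q_def flip: m_def)
      have "X k - S \<le> r ^ k * E 0" using E[of k] nonneg[of "z k - xs"] by (simp add: E_def)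
      moreover have "norm (z k - xs) \<le> r powr (real k / 2) * sqrt Q"
        using growth nonneg[of "x k - xs"] by (intro le) (simp add: E_def)
      moreover have "norm (x k - xs) \<le> r powr (real k / 2) * sqrt Q"
        using growth nonneg[of "z k - xs"] by (intro le) (simp add: E_def)
      ultimately show ?thesis
        unfolding Q' by (simp add: X S E_def m_def)
    qed
    then show "F (x k) - F xs
        \<le> ereal (r ^ k) * (F (x 0) - F xs + ereal ((\<mu> + \<rho>) / 2 * (norm (z 0 - xs))\<^sup>2))"
      "ereal (norm (z k - xs)) \<le> ereal (r powr (real k / 2)) * ereal_sqrt ?Q"
      "ereal (norm (x k - xs)) \<le> ereal (r powr (real k / 2)) * ereal_sqrt ?Q"
      by blast+
  qed
qed

end
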